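(* The following two assertions are equivalent. (i) For each $k\in\{0\}\cup\mathbb{N}$, $$D_k(x)\sim k!\,x(\log x)^{k-1}\qquad\text{as } x\to\infty .$$ (ii) For each $k\in\{0\}\cup\mathbb{N}$, $$\mu_{k,n}'\sim k!\,(\log n)^k\qquad\text{as } n\to\infty ,$$ that is, the $k$th moment of the first $n$ prime gaps is asymptotic to the $k$th moment $k!\,(\log n)^k$ of the exponential distribution with mean $\log n$.
   Context: $\mathbb{N}=\{1,2,\ldots\}$, and $p_n$ is the $n$th prime, with $p_1=2$. The $n$th gap is $d_n:=p_{n+1}-p_n$ for $n\in\mathbb{N}$. For real $x$ and $k\in\{0\}\cup\mathbb{N}$, $D_k(x):=\sum_{n\ge 1:\ p_{n+1}\le x} d_n^k$. The $k$th moment of the first $n$ gaps is $\mu_{k,n}':=\frac1n\sum_{j=1}^n d_j^k$. The notation $f\sim g$ means that $f/g\to 1$ as the argument tends to infinity. Assertion (i) is a conjecture of Oliveira e Silva, unproved for $k>1$. *)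

theory Defs
  imports
    "HOL-Probability.Probability"
    "HOL-Computational_Algebra.Primes"
    "HOL-Library.Infinite_Set"
    "HOL-Library.Landau_Symbols"
begin

(* enumerate counts from 0, so the shift makes nth_prime 1 = 2; the value at 0 is junk. *)
definition nth_prime :: "nat \<Rightarrow> nat" where
  "nth_prime n = enumerate {p. prime p} (n - 1)"

definition prime_gap :: "nat \<Rightarrow> real" where
  "prime_gap n = real (nth_prime (n + 1)) - real (nth_prime n)"

definition gap_power_sum :: "nat \<Rightarrow> real \<Rightarrow> real" where
  "gap_power_sum k x = (\<Sum>n | n \<ge> 1 \<and> real (nth_prime (n + 1)) \<le> x. prime_gap n ^ k)"

definition gap_moment :: "nat \<Rightarrow> nat \<Rightarrow> real" where
  "gap_moment k n = (1 / real n) * (\<Sum>j = 1..n. prime_gap j ^ k)"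

(* The index set of gap_power_sum is finite, so the sum never takes its default value 0
   for an infinite set. *)
lemma finite_gap_power_sum_index:
  "finite {n. n \<ge> 1 \<and> real (nth_prime (n + 1)) \<le> x}"
proof (rule finite_subset)
  show "{n. n \<ge> 1 \<and> real (nth_prime (n + 1)) \<le> x} \<subseteq> {..nat \<lceil>x\<rceil>}"
  proof
    fix n assume "n \<in> {n. n \<ge> 1 \<and> real (nth_prime (n + 1)) \<le> x}"
    moreover have "n \<le> nth_prime (n + 1)"
      unfolding nth_prime_def using le_enumerate[OF primes_infinite] by simp
    ultimately have "real n \<le> x" by (auto intro: order_trans[of _ "real (nth_prime (n + 1))"])
    then show "n \<in> {..nat \<lceil>x\<rceil>}" by (simp add: le_nat_iff) linarith
  qed
qed simp

lemma nth_prime_1: "nth_prime 1 = 2"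
  by (simp add: nth_prime_def enumerate_0 Least_equality prime_ge_2_nat two_is_prime_nat)

end

theory Submission
  imports Defs "HOL-Real_Asymp.Real_Asymp"
begin

text \<open>
  Write \<open>P n\<close> for the prime with index \<open>n + 1\<close> and \<open>S k n\<close> for the sum of the \<open>k\<close>-th powers of
  the first \<open>n\<close> gaps. The sum \<open>gap_power_sum k\<close> is a step function of \<open>x\<close> which is constant
  between consecutive primes and takes the value \<open>S k n = n * gap_moment k n\<close> at \<open>x = P n\<close>. Thus
  the two assertions differ only by the change of variable between \<open>n\<close> and \<open>P n\<close>.

  This change of variable needs the prime number theorem in the form \<open>P n \<sim> n * ln n\<close>, but each
  of the assertions contains it as a special case. In the first one, the case \<open>k = 0\<close> at
  \<open>x = P n\<close> reads \<open>n \<sim> P n / ln (P n)\<close>, whence \<open>ln n \<sim> ln (P n)\<close> and \<open>P n \<sim> n * ln n\<close>. In the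
  second one, the case \<open>k = 1\<close> is the assertion on \<open>(P n - 2) / n\<close>, because the sum of the gaps
  telescopes.

  Once \<open>P n \<sim> n * ln n\<close> is known, \<open>ln (P n) \<sim> ln n\<close> shows that \<open>k! * P n * ln (P n) powi (k - 1)\<close>
  and \<open>n * (k! * ln n ^ k)\<close> are asymptotically equal, so the second assertion is the first one
  restricted to the points \<open>x = P n\<close> (\<open>gap_moment_asymp_iff\<close>). Since
  \<open>P (n + 1) \<sim> P n\<close>, nothing is lost in the restriction (\<open>gap_power_sum_asymp_iff\<close>).

  The moments of the exponential distribution are those of the Erlang distribution of shape \<open>1\<close>.
\<close>

section \<open>Asymptotic equivalence of logarithms\<close>

lemma asymp_equiv_ln:
  fixes f g :: "'a \<Rightarrow> real"
  assumes "f \<sim>[F] g" "filterlim g at_top F"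
  shows "(\<lambda>x. ln (f x)) \<sim>[F] (\<lambda>x. ln (g x))"
proof -
  have f: "filterlim f at_top F"
    using asymp_equiv_at_top_transfer[OF asymp_equiv_symI[OF assms(1)] assms(2)] .
  have ev: "eventually (\<lambda>x. f x > 0 \<and> g x > 0) F"
    using f assms(2) by (simp add: eventually_conj filterlim_at_top_dense)
  have "((\<lambda>x. f x / g x) \<longlongrightarrow> 1) F"
    by (rule asymp_equivD_strong[OF assms(1)]) (use ev in eventually_elim, simp)
  hence "((\<lambda>x. ln (f x / g x)) \<longlongrightarrow> ln 1) F"
    by (intro tendsto_ln) auto
  moreover have "eventually (\<lambda>x. ln (f x / g x) = ln (f x) - ln (g x)) F"
    using ev by eventually_elim (simp add: ln_div)
  ultimately have lim: "((\<lambda>x. ln (f x) - ln (g x)) \<longlongrightarrow> 0) F"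
    by (simp add: tendsto_cong)
  have "filterlim (\<lambda>x. ln (g x)) at_infinity F"
    using filterlim_compose[OF ln_at_top assms(2)] filterlim_at_top_imp_at_infinity by blast
  hence "((\<lambda>x. (ln (f x) - ln (g x)) / ln (g x)) \<longlongrightarrow> 0) F"
    by (rule tendsto_divide_0[OF lim])
  moreover have "eventually (\<lambda>x. ln (g x) \<noteq> 0) F"
    using filterlim_compose[OF ln_at_top assms(2)] 
    unfolding filterlim_at_top_dense by (fastforce elim: eventually_mono)
  ultimately have "(\<lambda>x. ln (f x) - ln (g x)) \<in> o[F](\<lambda>x. ln (g x))"
    by (intro smalloI_tendsto)
  thus ?thesis
    by (rule smallo_imp_asymp_equiv)
qed

lemma asymp_equiv_powi:
  fixes f g :: "'a \<Rightarrow> 'b :: real_normed_field"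
  assumes "f \<sim>[F] g"
  shows "(\<lambda>x. f x powi m) \<sim>[F] (\<lambda>x. g x powi m)"
proof (cases "m \<ge> 0")
  case True
  thus ?thesis by (simp add: power_int_def asymp_equiv_power assms)
next
  case False
  thus ?thesis by (simp add: power_int_def asymp_equiv_power asymp_equiv_inverse assms)
qed

text \<open>If \<open>p \<sim> y * ln y\<close>, then the loglog term in \<open>ln p\<close> is negligible.\<close>

lemma ln_asymp_if_asymp_mult_ln:
  fixes p y :: "'a \<Rightarrow> real"
  assumes "p \<sim>[F] (\<lambda>x. y x * ln (y x))" "filterlim y at_top F"
  shows "(\<lambda>x. ln (p x)) \<sim>[F] (\<lambda>x. ln (y x))"
proof -
  have "filterlim (\<lambda>t::real. t * ln t) at_top at_top"
    by real_asymp
  from asymp_equiv_ln[OF assms(1) filterlim_compose[OF this assms(2)]]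
  have "(\<lambda>x. ln (p x)) \<sim>[F] (\<lambda>x. ln (y x * ln (y x)))" .
  also have "(\<lambda>t::real. ln (t * ln t)) \<sim>[at_top] (\<lambda>t. ln t)"
    by real_asymp
  from asymp_equiv_compose'[OF this assms(2)]
  have "(\<lambda>x. ln (y x * ln (y x))) \<sim>[F] (\<lambda>x. ln (y x))" .
  finally show ?thesis .
qed

text \<open>The function \<open>\<lambda>y. y * ln y\<close> is an asymptotic inverse of \<open>\<lambda>p. p / ln p\<close>.\<close>

lemma asymp_mult_ln_if_asymp_div_ln:
  fixes p y :: "'a \<Rightarrow> real"
  assumes "y \<sim>[F] (\<lambda>x. p x / ln (p x))" "filterlim p at_top F"
  shows "p \<sim>[F] (\<lambda>x. y x * ln (y x))"
proof -
  have "filterlim (\<lambda>t::real. t / ln t) at_top at_top"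
    by real_asymp
  from asymp_equiv_ln[OF assms(1) filterlim_compose[OF this assms(2)]]
  have "(\<lambda>x. ln (y x)) \<sim>[F] (\<lambda>x. ln (p x / ln (p x)))" .
  also have "(\<lambda>t::real. ln (t / ln t)) \<sim>[at_top] (\<lambda>t. ln t)"
    by real_asymp
  from asymp_equiv_compose'[OF this assms(2)]
  have "(\<lambda>x. ln (p x / ln (p x))) \<sim>[F] (\<lambda>x. ln (p x))" .
  finally have "(\<lambda>x. y x * ln (y x)) \<sim>[F] (\<lambda>x. p x / ln (p x) * ln (p x))"
    by (intro asymp_equiv_mult assms(1))
  moreover have "eventually (\<lambda>x. p x > 1) F"
    using assms(2) by (auto simp: filterlim_at_top_dense)
  hence "eventually (\<lambda>x. p x / ln (p x) * ln (p x) = p x) F"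
    by eventually_elim simp
  ultimately show ?thesis
    by (subst asymp_equiv_sym) (rule asymp_equiv_transfer, auto)
qed

section \<open>Sums over prime gaps\<close>

text \<open>
  The upper end of the gap with index \<open>n\<close>. The shift makes the sequence strictly increasing on
  all of \<open>nat\<close>, without the default value at index \<open>0\<close>.
\<close>

definition gap_end :: "nat \<Rightarrow> real" where
  "gap_end n = real (nth_prime (n + 1))"

lemma gap_end_less_iff: "gap_end m < gap_end n \<longleftrightarrow> m < n"
  by (simp add: gap_end_def nth_prime_def primes_infinite)

lemma gap_end_le_iff: "gap_end m \<le> gap_end n \<longleftrightarrow> m \<le> n"
  using gap_end_less_iff[of n m] by linarith

lemma gap_end_0: "gap_end 0 = 2"
  using nth_prime_1 by (simp add: gap_end_def)

lemma of_nat_le_gap_end: "real n \<le> gap_end n"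
  unfolding gap_end_def nth_prime_def using le_enumerate[OF primes_infinite] by simp

lemma filterlim_gap_end: "filterlim gap_end at_top at_top"
  by (rule filterlim_at_top_mono[OF filterlim_real_sequentially]) (simp add: of_nat_le_gap_end)

lemma gap_power_sum_at_gap_end: "gap_power_sum k (gap_end n) = real n * gap_moment k n"
proof -
  have "{j. j \<ge> 1 \<and> real (nth_prime (j + 1)) \<le> gap_end n} = {1..n}"
    unfolding gap_end_def[symmetric] by (auto simp: gap_end_le_iff)
  thus ?thesis
    by (simp add: gap_power_sum_def gap_moment_def)
qed

lemma gap_moment_0: "n > 0 \<Longrightarrow> gap_moment 0 n = 1"
  by (simp add: gap_moment_def)

lemma gap_moment_1: "gap_moment 1 n = (gap_end n - 2) / real n"
proof -
  have "(\<Sum>j = 1..n. prime_gap j) = gap_end n - 2"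
  proof (induction n)
    case (Suc n)
    thus ?case by (simp add: prime_gap_def gap_end_def)
  qed (simp add: gap_end_0)
  thus ?thesis
    by (simp add: gap_moment_def)
qed

text \<open>The number of gaps that end at or below \<open>x\<close>, that is, one less than the number of primes up
  to \<open>x\<close> when \<open>x \<ge> 2\<close>.\<close>

definition gap_count :: "real \<Rightarrow> nat" where
  "gap_count x = card {n. n \<ge> 1 \<and> gap_end n \<le> x}"

lemma gap_index_set_eq: "{n. n \<ge> 1 \<and> gap_end n \<le> x} = {1..gap_count x}"
proof -
  let ?A = "{n. n \<ge> 1 \<and> gap_end n \<le> x}"
  have fin: "finite ?A"
    using finite_gap_power_sum_index[of x] by (simp add: gap_end_def)
  have "\<exists>m. ?A = {1..m}"
  proof (cases "?A = {}")
    case True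
    thus ?thesis by (intro exI[of _ 0]) auto
  next
    case False
    have "n \<in> ?A" if "n \<in> {1..Max ?A}" for n
      using Max_in[OF fin False] that gap_end_le_iff[of n "Max ?A"] by auto
    moreover have "n \<in> {1..Max ?A}" if "n \<in> ?A" for n
      using Max_ge[OF fin that] that by auto
    ultimately show ?thesis by blast
  qed
  then obtain m where "?A = {1..m}" ..
  thus ?thesis
    by (simp add: gap_count_def)
qed

lemma gap_end_gap_count:
  assumes "x \<ge> 2"
  shows "gap_end (gap_count x) \<le> x" "x < gap_end (Suc (gap_count x))"
proof -
  show "gap_end (gap_count x) \<le> x"
  proof (cases "gap_count x = 0")
    case False
    hence "gap_count x \<in> {n. n \<ge> 1 \<and> gap_end n \<le> x}"
      by (subst gap_index_set_eq) simp
    thus ?thesis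
      by simp
  qed (use assms in \<open>simp add: gap_end_0\<close>)
  have "Suc (gap_count x) \<notin> {n. n \<ge> 1 \<and> gap_end n \<le> x}"
    unfolding gap_index_set_eq by simp
  thus "x < gap_end (Suc (gap_count x))"
    by simp
qed

lemma filterlim_gap_count: "filterlim gap_count at_top at_top"
  unfolding filterlim_at_top
proof
  fix m :: nat
  show "eventually (\<lambda>x. m \<le> gap_count x) at_top"
    using eventually_ge_at_top[of "max 2 (gap_end m)"]
  proof eventually_elim
    case (elim x)
    hence "gap_end m < gap_end (Suc (gap_count x))"
      using gap_end_gap_count(2)[of x] by linarith
    thus ?case
      by (simp add: gap_end_less_iff)
  qed
qed

text \<open>For \<open>x < 2\<close> the argument \<open>gap_end 0 = 2\<close> exceeds \<open>x\<close>, but both sums are empty.\<close>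

lemma gap_power_sum_gap_count:
  "gap_power_sum k x = gap_power_sum k (gap_end (gap_count x))"
proof -
  have "{n. n \<ge> 1 \<and> gap_end n \<le> gap_end (gap_count x)} = {n. n \<ge> 1 \<and> gap_end n \<le> x}"
    by (subst gap_index_set_eq) (auto simp: gap_end_le_iff)
  thus ?thesis
    by (simp add: gap_power_sum_def gap_end_def)
qed

section \<open>Passage between primes and their indices\<close>

lemma gap_power_sum_asymp_iff:
  assumes "gap_end \<sim>[at_top] (\<lambda>n. real n * ln (real n))"
  shows "gap_power_sum k \<sim>[at_top] (\<lambda>x. fact k * x * ln x powi m) \<longleftrightarrow>
         (\<lambda>n. gap_power_sum k (gap_end n)) \<sim>[at_top]
           (\<lambda>n. fact k * gap_end n * ln (gap_end n) powi m)"
    (is "?on_reals \<longleftrightarrow> ?on_primes")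
proof
  assume ?on_reals
  thus ?on_primes
    by (rule asymp_equiv_compose'[OF _ filterlim_gap_end])
next
  assume ?on_primes
  have "(\<lambda>n. gap_end (Suc n)) \<sim>[at_top] (\<lambda>n. real (Suc n) * ln (real (Suc n)))"
    by (rule asymp_equiv_compose'[OF assms filterlim_Suc])
  also have "(\<lambda>n. real (Suc n) * ln (real (Suc n))) \<sim>[at_top] (\<lambda>n. real n * ln (real n))"
    by real_asymp
  also note asymp_equiv_symI[OF assms]
  finally have "(\<lambda>x. gap_end (Suc (gap_count x))) \<sim>[at_top] (\<lambda>x. gap_end (gap_count x))"
    by (rule asymp_equiv_compose'[OF _ filterlim_gap_count])
  \<comment> \<open>Every \<open>x \<ge> 2\<close> lies between two consecutive primes, whose quotient tends to \<open>1\<close>.\<close>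
  hence x: "(\<lambda>x. x) \<sim>[at_top] (\<lambda>x. gap_end (gap_count x))"
  proof (rule asymp_equiv_sandwich_real[OF asymp_equiv_refl])
    show "eventually (\<lambda>x. x \<in> {gap_end (gap_count x)..gap_end (Suc (gap_count x))}) at_top"
      using eventually_ge_at_top[of 2]
      by eventually_elim (use gap_end_gap_count in \<open>auto intro: less_imp_le\<close>)
  qed
  have "filterlim (\<lambda>x. gap_end (gap_count x)) at_top at_top"
    by (rule filterlim_compose[OF filterlim_gap_end filterlim_gap_count])
  note ln_x = asymp_equiv_ln[OF x this]
  have "(\<lambda>x. gap_power_sum k (gap_end (gap_count x))) \<sim>[at_top]
      (\<lambda>x. fact k * gap_end (gap_count x) * ln (gap_end (gap_count x)) powi m)"
    by (rule asymp_equiv_compose'[OF \<open>?on_primes\<close> filterlim_gap_count])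
  also have "\<dots> \<sim>[at_top] (\<lambda>x. fact k * x * ln x powi m)"
    by (intro asymp_equiv_mult asymp_equiv_powi asymp_equiv_refl asymp_equiv_symI[OF x]
          asymp_equiv_symI[OF ln_x])
  finally show ?on_reals
    by (simp only: gap_power_sum_gap_count[symmetric])
qed

lemma gap_moment_asymp_iff:
  assumes "gap_end \<sim>[at_top] (\<lambda>n. real n * ln (real n))"
  shows "gap_moment k \<sim>[at_top] (\<lambda>n. fact k * ln (real n) ^ k) \<longleftrightarrow>
         (\<lambda>n. gap_power_sum k (gap_end n)) \<sim>[at_top]
           (\<lambda>n. fact k * gap_end n * ln (gap_end n) powi (int k - 1))"
    (is "?moment \<longleftrightarrow> ?sum")
proof -
  have "(\<lambda>n. fact k * gap_end n * ln (gap_end n) powi (int k - 1)) \<sim>[at_top]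
        (\<lambda>n. fact k * (real n * ln (real n)) * ln (real n) powi (int k - 1))"
    by (intro asymp_equiv_mult asymp_equiv_powi asymp_equiv_refl assms
          ln_asymp_if_asymp_mult_ln filterlim_real_sequentially)
  also have "\<dots> \<sim>[at_top] (\<lambda>n. real n * (fact k * ln (real n) ^ k))"
  proof (rule asymp_equiv_refl_ev)
    show "eventually (\<lambda>n. fact k * (real n * ln (real n)) * ln (real n) powi (int k - 1) =
       real n * (fact k * ln (real n) ^ k)) at_top"
      using eventually_gt_at_top[of 1]
    proof eventually_elim
      case (elim n)
      hence "ln (real n) powi (int k - 1) * ln (real n) = ln (real n) ^ k"
        by (subst power_int_minus_mult) auto
      thus ?case
        by (simp add: mult_ac)
    qed
  qed
  finally have rhs: "(\<lambda>n. fact k * gap_end n * ln (gap_end n) powi (int k - 1)) \<sim>[at_top]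
         (\<lambda>n. real n * (fact k * ln (real n) ^ k))" .
  have "?sum \<longleftrightarrow> (\<lambda>n. real n * gap_moment k n) \<sim>[at_top]
                   (\<lambda>n. real n * (fact k * ln (real n) ^ k))"
    unfolding gap_power_sum_at_gap_end
    using rhs by (meson asymp_equiv_sym asymp_equiv_trans)
  also have "\<dots> \<longleftrightarrow> ?moment"
  proof
    assume "(\<lambda>n. real n * gap_moment k n) \<sim>[at_top] (\<lambda>n. real n * (fact k * ln (real n) ^ k))"
    from asymp_equiv_divide[OF this asymp_equiv_refl[of real]] show ?moment
      by (rule asymp_equiv_transfer)
         (rule eventually_mono[OF eventually_gt_at_top[of 0]], simp)+
  qed (intro asymp_equiv_mult asymp_equiv_refl)
  finally show ?thesis ..
qed

text \<open>The case \<open>k = 0\<close> of the assertion on power sums implies the prime number theorem.\<close>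

lemma gap_end_asymp_if_gap_power_sum_0:
  assumes "gap_power_sum 0 \<sim>[at_top] (\<lambda>x. x / ln x)"
  shows "gap_end \<sim>[at_top] (\<lambda>n. real n * ln (real n))"
proof (rule asymp_mult_ln_if_asymp_div_ln[OF _ filterlim_gap_end])
  have "gap_power_sum 0 (gap_end n) = real n" for n
    by (cases "n = 0") (simp_all add: gap_power_sum_at_gap_end gap_moment_0)
  thus "real \<sim>[at_top] (\<lambda>n. gap_end n / ln (gap_end n))"
    using asymp_equiv_compose'[OF assms filterlim_gap_end] by simp
qed

text \<open>So does the case \<open>k = 1\<close> of the assertion on moments.\<close>

lemma gap_end_asymp_if_gap_moment_1:
  assumes "gap_moment 1 \<sim>[at_top] (\<lambda>n. ln (real n))"
  shows "gap_end \<sim>[at_top] (\<lambda>n. real n * ln (real n))"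
proof -
  have "(\<lambda>n. real n * gap_moment 1 n) \<sim>[at_top] (\<lambda>n. real n * ln (real n))"
    by (intro asymp_equiv_mult asymp_equiv_refl assms)
  moreover have "eventually (\<lambda>n. real n * gap_moment 1 n = gap_end n - 2) at_top"
    using eventually_gt_at_top[of 0] by eventually_elim (simp add: gap_moment_1 del: One_nat_def)
  ultimately have *: "(\<lambda>n. gap_end n - 2) \<sim>[at_top] (\<lambda>n. real n * ln (real n))"
    by (rule asymp_equiv_transfer) auto
  have "(\<lambda>n. 2 :: real) \<in> o(\<lambda>n. real n * ln (real n))"
    by real_asymp
  also have "(\<lambda>n. real n * ln (real n)) \<in> \<Theta>(\<lambda>n. gap_end n - 2)"
    by (rule asymp_equiv_imp_bigtheta[OF asymp_equiv_symI[OF *]])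
  finally have "(\<lambda>n. (gap_end n - 2) + 2) \<sim>[at_top] (\<lambda>n. gap_end n - 2)"
    by (intro smallo_imp_asymp_equiv) simp
  from asymp_equiv_trans[OF this *] show ?thesis
    by simp
qed

section \<open>Moments of the exponential distribution\<close>

lemma has_bochner_integral_exponential_moment:
  assumes "l > 0"
  shows "has_bochner_integral (density lborel (exponential_density l)) (\<lambda>t. t ^ k) (fact k / l ^ k)"
proof -
  interpret prob_space "density lborel (exponential_density l)"
    by (rule prob_space_exponential_density[OF assms])
  have "distributed (density lborel (exponential_density l)) lborel (\<lambda>t. t) (exponential_density l)"
    unfolding distributed_def by (intro conjI distr_id2) simp_all
  from has_bochner_integral_erlang_ith_moment[OF assms this, of k] show ?thesis
    by simp
qed

section \<open>The equivalence\<close>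

theorem theorem3:
  shows "((\<forall>k::nat. gap_power_sum k \<sim>[at_top] (\<lambda>x::real. fact k * x * ln x powi (int k - 1)))
          \<longleftrightarrow>
          (\<forall>k::nat. gap_moment k \<sim>[at_top] (\<lambda>n::nat. fact k * ln (real n) ^ k)))
         \<and>
         (\<forall>(k::nat) (n::nat). n \<ge> 2 \<longrightarrow>
            has_bochner_integral (density lborel (exponential_density (1 / ln (real n))))
              (\<lambda>t. t ^ k) (fact k * ln (real n) ^ k))"
    (is "(?sums \<longleftrightarrow> ?moments) \<and> ?exponential")
proof
  have iff: "?sums \<longleftrightarrow> ?moments" if "gap_end \<sim>[at_top] (\<lambda>n. real n * ln (real n))"
    by (simp only: gap_power_sum_asymp_iff[OF that] gap_moment_asymp_iff[OF that])
  show "?sums \<longleftrightarrow> ?moments"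
  proof
    assume sums: ?sums
    have "gap_power_sum 0 \<sim>[at_top] (\<lambda>x. x / ln x)"
      using sums[rule_format, of 0] by (simp add: power_int_minus divide_inverse)
    from iff[OF gap_end_asymp_if_gap_power_sum_0[OF this]] sums show ?moments
      by blast
  next
    assume moments: ?moments
    have "gap_moment 1 \<sim>[at_top] (\<lambda>n. ln (real n))"
      using moments[rule_format, of 1] by simp
    from iff[OF gap_end_asymp_if_gap_moment_1[OF this]] moments show ?sums
      by blast
  qed
  show ?exponential
  proof (intro allI impI)
    fix k n :: nat
    assume "n \<ge> 2"
    hence "1 / ln (real n) > 0"
      by simp
    from has_bochner_integral_exponential_moment[OF this, of k]
    show "has_bochner_integral (density lborel (exponential_density (1 / ln (real n))))
            (\<lambda>t. t ^ k) (fact k * ln (real n) ^ k)"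
      by (simp add: power_one_over)
  qed
qed

end
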